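(* The solution $w$ described in the context is strictly convex in $y$.
   Context: Constants: $T,\lambda,\mu,\sigma>0$; $p_1,p_2\in(0,1)$ with $p_1>p_2$; $\xi:=\frac{\mu^2}{2\sigma^2}$; $q_1<0$ defined by $\frac1{p_1}+\frac1{q_1}=1$; $f(t):=\exp(-\xi(T-t))$. The solution $w$: $w$ denotes the fixed solution provided by the following existence result. For some $\gamma\in(0,1)$ there is a solution $w\in C^{1+\gamma/2,2+\gamma}([0,T]\times(0,\infty))$ (usual parabolic Hölder class) to $$w_t-\lambda w+\lambda y w_y+\xi y^2w_{yy}+\lambda f(t)\frac{(-w_y)^{p_2}}{p_2}=0,\qquad w(T,y)=-\frac{y^{q_1}}{q_1},$$ such that: (i) $w(t,y)>-\exp\{(q_1-1)(\lambda+\xi q_1)(T-t)\}\frac{y^{q_1}}{q_1}>0$; (ii) $w$ is strictly decreasing in $y$; (iii) there are $\eta,C>0$ (depending on $T$) with $w(t,y)\le C(1+y^{-\eta})$ for all $(t,y)\in[0,T]\times(0,\infty)$. *)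

theory Defs
  imports "HOL-Analysis.Analysis"
begin

text \<open>
  Functions of time and space are curried, w t y. The time derivative is taken
  within the closed interval, so it is one-sided at t = 0 and t = T. The two operators are
  only meaningful where the corresponding derivative exists, which the class below demands.
\<close>

definition dt :: "real \<Rightarrow> (real \<Rightarrow> real \<Rightarrow> real) \<Rightarrow> real \<Rightarrow> real \<Rightarrow> real" where
  "dt T w t y = vector_derivative (\<lambda>s. w s y) (at t within {0..T})"

definition dy :: "(real \<Rightarrow> real \<Rightarrow> real) \<Rightarrow> real \<Rightarrow> real \<Rightarrow> real" where
  "dy w t y = deriv (\<lambda>x. w t x) y"

definition C12 :: "real \<Rightarrow> (real \<Rightarrow> real \<Rightarrow> real) \<Rightarrow> bool" where
  "C12 T w \<longleftrightarrow>
     (\<forall>t\<in>{0..T}. \<forall>y>0.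
        (\<lambda>s. w s y) differentiable (at t within {0..T}) \<and>
        (\<lambda>x. w t x) differentiable (at y) \<and>
        (\<lambda>x. dy w t x) differentiable (at y)) \<and>
     (\<forall>g\<in>{w, dt T w, dy w, dy (dy w)}.
        continuous_on ({0..T} \<times> {0<..}) (\<lambda>(t, y). g t y))"

text \<open>Hoelder continuity of exponent \<gamma> with respect to the parabolic distance.\<close>

definition parabolic_holder_on ::
    "real \<Rightarrow> (real \<times> real) set \<Rightarrow> (real \<Rightarrow> real \<Rightarrow> real) \<Rightarrow> bool" where
  "parabolic_holder_on \<gamma> Q g \<longleftrightarrow>
     (\<exists>K. \<forall>(t, y)\<in>Q. \<forall>(s, x)\<in>Q.
        \<bar>g t y - g s x\<bar> \<le> K * (\<bar>t - s\<bar> powr (\<gamma> / 2) + \<bar>y - x\<bar> powr \<gamma>))"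

text \<open>
  The class with time exponent 1 + \<gamma>/2 and space exponent 2 + \<gamma> on the closed time interval
  times the open half-line. As usual for a domain that is not compact, the Hoelder bounds are
  required on compact subsets, and rectangles suffice for that. A single global
  bound would be contradictory for a function with terminal value - y powr q / q, q < 0,
  which is unbounded near y = 0. The suprema of w and its derivatives on a rectangle are
  finite by continuity and hence not listed.
\<close>

definition parabolic_holder_class :: "real \<Rightarrow> real \<Rightarrow> (real \<Rightarrow> real \<Rightarrow> real) \<Rightarrow> bool" where
  "parabolic_holder_class \<gamma> T w \<longleftrightarrow>
     C12 T w \<and>
     (\<forall>a b. 0 < a \<and> a < b \<longrightarrow>
        parabolic_holder_on \<gamma> ({0..T} \<times> {a..b}) (dt T w) \<and>
        parabolic_holder_on \<gamma> ({0..T} \<times> {a..b}) (dy (dy w)))"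

definition strictly_convex_on :: "real set \<Rightarrow> (real \<Rightarrow> real) \<Rightarrow> bool" where
  "strictly_convex_on S g \<longleftrightarrow> convex S \<and>
     (\<forall>x\<in>S. \<forall>y\<in>S. \<forall>u. x \<noteq> y \<longrightarrow> 0 < u \<longrightarrow> u < 1 \<longrightarrow>
        g ((1 - u) * x + u * y) < (1 - u) * g x + u * g y)"

end

theory Submission
  imports Defs
begin

text \<open>
  In the variable z = ln y the equation has constant coefficients, except that the Hamiltonian
  carries the factor exp (- p z), which is convex in z. Comparison with an explicit supersolution
  shows that K(t) exp (q z) / (- q) is the exact leading term of w as z \<rightarrow> -\<infinity> and that w vanishes
  as z \<rightarrow> \<infinity>. A maximum principle for the convexity gap of w over two points and an intermediate
  point then gives convexity in ln y: the gradients at the three points agree at a maximum, so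
  the nonlinearity has the right sign. Since w is strictly decreasing and the geometric mean is
  strictly below the arithmetic one, convexity in ln y implies strict convexity in y.
\<close>

section \<open>Necessary conditions at a maximum and existence of maxima\<close>

text \<open>A positive \<open>d\<close> would make \<open>g'\<close> positive just to the right of
  the critical point \<open>x\<close>, and the mean value theorem would then give a value of
  \<open>g\<close> above \<open>g x\<close>.\<close>

lemma derivative_tests_at_max:
  fixes g g' :: "real \<Rightarrow> real"
  assumes d1: "\<And>h. (g has_real_derivative g' h) (at h)"
    and d2: "(g' has_real_derivative d) (at x)"
    and max: "\<And>h. g h \<le> g x"
  shows "g' x = 0" and "d \<le> 0"
proof -
  show zero: "g' x = 0"
    using DERIV_local_max[OF d1, of 1 x] max by auto
  show "d \<le> 0"
  proof (rule ccontr)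
    assume "\<not> d \<le> 0"
    then obtain e where e: "e > 0" "\<And>h. 0 < h \<Longrightarrow> h < e \<Longrightarrow> g' x < g' (x + h)"
      using DERIV_pos_inc_right[OF d2] by auto
    obtain c where c: "x < c" "c < x + e / 2" "g (x + e / 2) - g x = (x + e / 2 - x) * g' c"
      using MVT2[of x "x + e / 2" g g'] d1 e(1) by auto
    have "g' c > 0"
      using e(2)[of "c - x"] c(1,2) e(1) zero by auto
    with e(1) have "e / 2 * g' c > 0" by simp
    with c(3) have "g (x + e / 2) > g x" by simp
    with max[of "x + e / 2"] show False by simp
  qed
qed

text \<open>Only steps forward in time are compared, so the test also works at \<open>t = 0\<close>,
  where the derivative is one-sided; \<open>t < T\<close> leaves room for such a step. This
  direction suits an equation with terminal data.\<close>

lemma derivative_nonpos_at_max_within: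
  fixes g :: "real \<Rightarrow> real"
  assumes d: "(g has_real_derivative d) (at t within {0..T})"
    and t: "0 \<le> t" "t < T"
    and max: "\<And>s. s \<in> {0..T} \<Longrightarrow> g s \<le> g t"
  shows "d \<le> 0"
proof (rule ccontr)
  assume "\<not> d \<le> 0"
  then obtain e where e: "e > 0"
      "\<And>h. 0 < h \<Longrightarrow> t + h \<in> {0..T} \<Longrightarrow> h < e \<Longrightarrow> g t < g (t + h)"
    using has_real_derivative_pos_inc_right[OF d] by auto
  define h where "h = min (e / 2) (T - t)"
  have "0 < h" "h < e" "t + h \<in> {0..T}"
    using e(1) t by (auto simp: h_def)
  with e(2) max show False by (meson not_le)
qed

text \<open>Outside \<open>S\<close> all values stay below one reference value, so the maximum over
  the compact set \<open>{0..T} \<times> S\<close> is global. The space type is general because the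
  lemma serves one comparison on the line and one over pairs of points.\<close>

lemma global_max_exists:
  fixes F :: "real \<Rightarrow> 'a::topological_space \<Rightarrow> real"
  assumes cont: "continuous_on ({0..T} \<times> UNIV) (\<lambda>(t, x). F t x)"
    and t0: "t0 \<in> {0..T}" and S: "compact S"
    and out: "\<And>t x. t \<in> {0..T} \<Longrightarrow> x \<notin> S \<Longrightarrow> F t x < F t0 x0"
  obtains t x where "t \<in> {0..T}" "F t0 x0 \<le> F t x"
    "\<And>s y. s \<in> {0..T} \<Longrightarrow> F s y \<le> F t x"
proof -
  have x0: "x0 \<in> S" using out[OF t0] by blast
  have "compact ({0..T} \<times> S)" using S by (intro compact_Times) auto
  moreover have "{0..T} \<times> S \<noteq> {}" using t0 x0 by auto
  moreover have "continuous_on ({0..T} \<times> S) (\<lambda>(t, x). F t x)"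
    by (rule continuous_on_subset[OF cont]) auto
  ultimately obtain p where p: "p \<in> {0..T} \<times> S"
      "\<And>q. q \<in> {0..T} \<times> S \<Longrightarrow> (\<lambda>(t, x). F t x) q \<le> (\<lambda>(t, x). F t x) p"
    using continuous_attains_sup by metis
  obtain t x where tx: "p = (t, x)" by force
  have le: "F s y \<le> F t x" if "s \<in> {0..T}" "y \<in> S" for s y
    using p(2)[of "(s, y)"] that tx by auto
  show ?thesis
  proof (rule that)
    show "t \<in> {0..T}" using p(1) tx by auto
    show "F t0 x0 \<le> F t x" using le t0 x0 by auto
    then show "F s y \<le> F t x" if "s \<in> {0..T}" for s y
      using le[OF that] out[OF that] by (meson less_eq_real_def order.trans)
  qed
qed

section \<open>Inequalities for powers and exponentials\<close>

text \<open>Concavity puts the power below its tangent at \<open>a\<close>. Here this is Young's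
  inequality for \<open>a + b\<close> and \<open>a\<close> with weights \<open>p\<close> and
  \<open>1 - p\<close>, multiplied by \<open>a powr (p - 1)\<close>.\<close>

lemma powr_tangent_upper:
  fixes a b p :: real
  assumes "0 < a" "0 \<le> b" "0 < p" "p < 1"
  shows "(a + b) powr p \<le> a powr p + p * a powr (p - 1) * b"
proof -
  have "(a + b) powr p * a powr (1 - p) \<le> p * (a + b) + (1 - p) * a"
    using Youngs_inequality_0[of p "1 - p" "a + b" a] assms by auto
  then have "(a + b) powr p * a powr (1 - p) * a powr (p - 1) \<le> (a + p * b) * a powr (p - 1)"
    by (intro mult_right_mono) (auto simp: algebra_simps)
  moreover have "a powr (1 - p) * a powr (p - 1) = 1"
    using assms by (simp flip: powr_add)
  moreover have "a * a powr (p - 1) = a powr p"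
    using assms by (simp add: powr_mult_base)
  moreover have "(a + p * b) * a powr (p - 1) = a * a powr (p - 1) + p * a powr (p - 1) * b"
    by (simp add: algebra_simps)
  ultimately show ?thesis by (simp add: mult.assoc)
qed

text \<open>After division by \<open>a + b\<close> both parts lie in [0, 1] and sum to 1, and
  raising them to a power \<open>p < 1\<close> does not decrease them.\<close>

lemma powr_subadditive:
  fixes a b p :: real
  assumes "0 \<le> a" "0 \<le> b" "0 < p" "p < 1"
  shows "(a + b) powr p \<le> a powr p + b powr p"
proof (cases "a + b = 0")
  case False
  define c where "c = a + b"
  have c: "c > 0" using assms False by (simp add: c_def)
  have le: "x / c \<le> (x / c) powr p" if "0 \<le> x" "x \<le> c" for x
    using powr_mono'[of p 1 "x / c"] that assms c by (cases "x = 0") auto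
  have "1 = a / c + b / c" using c by (simp add: c_def flip: add_divide_distrib)
  also have "\<dots> \<le> (a / c) powr p + (b / c) powr p"
    using le[of a] le[of b] assms by (simp add: c_def)
  also have "\<dots> = (a powr p + b powr p) / c powr p"
    using assms c by (simp add: powr_divide add_divide_distrib)
  finally show ?thesis using c by (simp add: c_def field_simps)
qed (use assms in auto)

lemma exp_between:
  fixes a b c z :: real
  assumes "a \<le> b" "b \<le> c"
  shows "exp (- b * z) \<le> exp (- a * z) + exp (- c * z)"
proof (cases "z \<ge> 0")
  case True
  then have "exp (- b * z) \<le> exp (- a * z)" using assms by (simp add: mult_right_mono)
  then show ?thesis by (smt (verit) exp_ge_zero)
next
  case False
  then have "exp (- b * z) \<le> exp (- c * z)" using assms by (simp add: mult_right_mono_neg)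
  then show ?thesis by (smt (verit) exp_ge_zero)
qed

lemma exp_scaled_convex:
  fixes c u x y :: real
  assumes "0 < u" "u < 1"
  shows "exp (c * ((1 - u) * x + u * y)) \<le> (1 - u) * exp (c * x) + u * exp (c * y)"
proof -
  have "convex_on UNIV (exp :: real \<Rightarrow> real)"
    by (rule exp_convex)
  then have "exp ((1 - u) *\<^sub>R (c * x) + u *\<^sub>R (c * y)) \<le> (1 - u) * exp (c * x) + u * exp (c * y)"
    using assms by (intro convex_onD) auto
  then show ?thesis by (simp add: algebra_simps)
qed

section \<open>The equation in the variable z = ln y\<close>

text \<open>For \<open>W t z = w t (exp z)\<close>, y w_y becomes \<open>Wz\<close> and y^2 w_yy
  becomes \<open>Wzz - Wz\<close>; hence the drift coefficient \<open>lam - \<xi>\<close> and the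
  weight \<open>exp (- p * z)\<close>. The second condition on \<open>q\<close> means
  \<open>p / (1 - p) < - q\<close>, which is how \<open>p2 < p1\<close> enters.\<close>

locale log_equation =
  fixes T lam \<xi> p q \<eta> C :: real
    and f :: "real \<Rightarrow> real"
    and W Wt Wz Wzz :: "real \<Rightarrow> real \<Rightarrow> real"
  assumes pos: "T > 0" "lam > 0" "\<xi> > 0" "\<eta> > 0" "C > 0"
    and p: "0 < p" "p < 1"
    and q: "q < 0" "p < - q * (1 - p)"
    and f: "\<And>t. t \<in> {0..T} \<Longrightarrow> 0 < f t" "\<And>t. t \<in> {0..T} \<Longrightarrow> f t \<le> 1"
    and cont: "continuous_on ({0..T} \<times> UNIV) (\<lambda>(t, z). W t z)"
    and W_t: "\<And>t z. t \<in> {0..T} \<Longrightarrow>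
      ((\<lambda>s. W s z) has_real_derivative Wt t z) (at t within {0..T})"
    and W_z: "\<And>t z. t \<in> {0..T} \<Longrightarrow> (W t has_real_derivative Wz t z) (at z)"
    and W_zz: "\<And>t z. t \<in> {0..T} \<Longrightarrow> (Wz t has_real_derivative Wzz t z) (at z)"
    and W_z_nonpos: "\<And>t z. t \<in> {0..T} \<Longrightarrow> Wz t z \<le> 0"
    and pde: "\<And>t z. t \<in> {0..T} \<Longrightarrow>
      Wt t z - lam * W t z + (lam - \<xi>) * Wz t z + \<xi> * Wzz t z
        + lam * f t / p * (exp (- p * z) * (- Wz t z) powr p) = 0"
    and terminal: "\<And>z. W T z = exp (q * z) / (- q)"
    and lower: "\<And>t z. t \<in> {0..T} \<Longrightarrow>
      exp ((q - 1) * (lam + \<xi> * q) * (T - t)) * exp (q * z) / (- q) \<le> W t z"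
    and growth: "\<And>t z. t \<in> {0..T} \<Longrightarrow> W t z \<le> C * (1 + exp (- \<eta> * z))"
begin

section \<open>Supersolution and exact leading term\<close>

text \<open>This is the factor for which \<open>K t * exp (q * z)\<close> solves the equation
  without its power term, normalized by \<open>K T = 1\<close>.\<close>

definition K :: "real \<Rightarrow> real" where
  "K t = exp ((q - 1) * (lam + \<xi> * q) * (T - t))"

definition r where "r = (1 - q) * p"
definition s where "s = p / (1 - p)"

text \<open>The condition on \<open>q\<close> gives \<open>s < - q\<close>, and then
  \<open>s = p + s * p\<close> yields \<open>s \<le> r\<close>. By \<open>r < - q\<close> both
  barrier exponentials are of lower order than \<open>exp (q * z)\<close> as z tends to minus
  infinity. The rate \<open>(r + 1) * p\<close>, which the Hamiltonian produces from
  \<open>exp (- r * z)\<close>, lies between \<open>s\<close> and \<open>r\<close> and can be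
  absorbed.\<close>

lemma exponents: "0 < s" "s \<le> r" "r < - q" "s * (1 - p) = p" "s \<le> (r + 1) * p" "(r + 1) * p \<le> r"
proof -
  show s: "0 < s" and sp: "s * (1 - p) = p" using p by (auto simp: s_def)
  have "s < - q" using q p by (simp add: s_def field_simps)
  then have "s * p < - q * p" using p by (intro mult_strict_right_mono) auto
  moreover have "s - s * p = p" using sp by (simp add: algebra_simps)
  ultimately show sr: "s \<le> r" by (simp add: r_def algebra_simps)
  show "r < - q" using q by (simp add: r_def algebra_simps)
  have "s * p \<le> r * p" "s * (1 - p) \<le> r * (1 - p)"
    using sr p by (auto intro!: mult_right_mono)
  then show "s \<le> (r + 1) * p" "(r + 1) * p \<le> r"
    using sp by (auto simp: algebra_simps)
qed

lemma K_bounds: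
  shows "\<exists>k>0. \<forall>t\<in>{0..T}. k \<le> K t" and "\<exists>k>0. \<forall>t\<in>{0..T}. K t \<le> k"
proof -
  define c where "c = (q - 1) * (lam + \<xi> * q)"
  have "exp (- \<bar>c\<bar> * T) \<le> K t \<and> K t \<le> exp (\<bar>c\<bar> * T)" if "t \<in> {0..T}" for t
  proof -
    have "\<bar>c * (T - t)\<bar> \<le> \<bar>c\<bar> * T"
      using that by (simp add: abs_mult mult_left_mono)
    then show ?thesis unfolding K_def c_def[symmetric]
      by (metis abs_le_iff exp_le_cancel_iff minus_le_iff mult_minus_left)
  qed
  then show "\<exists>k>0. \<forall>t\<in>{0..T}. k \<le> K t" "\<exists>k>0. \<forall>t\<in>{0..T}. K t \<le> k"
    using exp_gt_zero by blast+
qed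

text \<open>
  The exponent s is the one for which the Hamiltonian reproduces exp (- s z), while r is
  produced by the leading term exp (q z).
\<close>

lemma hamiltonian_barrier_le:
  assumes K: "0 \<le> \<kappa>" and E: "1 \<le> E" and b: "0 \<le> b"
  shows "exp (- p * z) * (\<kappa> * exp (q * z) + E * (s * exp (- s * z) + r * exp (- r * z)) + b) powr p
    \<le> E * (\<kappa> powr p + s powr p + r powr p) * (exp (- s * z) + exp (- r * z))
       + p * s powr (p - 1) * b"
proof -
  define a where "a = \<kappa> * exp (q * z) + E * (s * exp (- s * z) + r * exp (- r * z))"
  note ex = exponents
  have r0: "0 < r" using ex by simp
  \<comment> \<open>This floor for \<open>a\<close> later bounds the tangent slope
    \<open>a powr (p - 1)\<close>.\<close>
  have "E * (s * exp (- s * z)) \<ge> s * exp (- s * z)"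
    using mult_right_mono[OF E, of "s * exp (- s * z)"] ex(1) by simp
  then have a_ge: "s * exp (- s * z) \<le> a"
    using K E r0 unfolding a_def distrib_left
    by (smt (verit) exp_gt_zero mult_nonneg_nonneg)
  then have a0: "0 < a" using ex(1) by (smt (verit) exp_gt_zero mult_pos_pos)
  \<comment> \<open>Replacing the power by \<open>E\<close> keeps the final bound linear in
    \<open>E\<close>, as the comparison requires.\<close>
  have Ep: "E powr p \<le> E" using powr_mono[of p 1 E] E p by auto
  have "a powr p \<le> (\<kappa> * exp (q * z)) powr p + (E * (s * exp (- s * z) + r * exp (- r * z))) powr p"
    unfolding a_def using K E ex r0 p by (intro powr_subadditive) auto
  also have "\<dots> \<le> \<kappa> powr p * exp (q * z * p)
      + E * (s powr p * exp (- s * z * p) + r powr p * exp (- r * z * p))"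
  proof -
    have "(s * exp (- s * z) + r * exp (- r * z)) powr p
        \<le> (s * exp (- s * z)) powr p + (r * exp (- r * z)) powr p"
      using ex r0 p by (intro powr_subadditive) auto
    also have "\<dots> = s powr p * exp (- s * z * p) + r powr p * exp (- r * z * p)"
      using ex r0 by (simp add: powr_mult exp_powr_real)
    finally have "E powr p * (s * exp (- s * z) + r * exp (- r * z)) powr p
        \<le> E * (s powr p * exp (- s * z * p) + r powr p * exp (- r * z * p))"
      using Ep E by (intro mult_mono) auto
    then show ?thesis using K E ex r0 by (simp add: powr_mult exp_powr_real)
  qed
  finally have "exp (- p * z) * a powr p \<le> exp (- p * z) * (\<kappa> powr p * exp (q * z * p)
      + E * (s powr p * exp (- s * z * p) + r powr p * exp (- r * z * p)))"
    by (intro mult_left_mono) auto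
  also have "\<dots> = \<kappa> powr p * (exp (- p * z) * exp (q * z * p))
      + E * (s powr p * (exp (- p * z) * exp (- s * z * p)) + r powr p * (exp (- p * z) * exp (- r * z * p)))"
    by (simp only: algebra_simps)
  also have "\<dots> = \<kappa> powr p * exp (- r * z) + E * (s powr p * exp (- s * z) + r powr p * exp (- ((r + 1) * p) * z))"
  proof -
    have "- p * z + q * z * p = - r * z" by (simp add: r_def algebra_simps)
    moreover have "- p * z + (- s * z * p) = - s * z"
    proof -
      have "- p * z + (- s * z * p) = - (s * (1 - p)) * z - s * z * p" by (simp add: ex(4))
      then show ?thesis by (simp add: algebra_simps)
    qed
    moreover have "- p * z + (- r * z * p) = - ((r + 1) * p) * z" by (simp add: algebra_simps)
    ultimately show ?thesis by (simp only: exp_add[symmetric])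
  qed
  also have "\<dots> \<le> E * (\<kappa> powr p + s powr p + r powr p) * (exp (- s * z) + exp (- r * z))"
  proof -
    let ?e = "exp (- s * z) + exp (- r * z)"
    have \<kappa>: "\<kappa> powr p * exp (- r * z) \<le> E * (\<kappa> powr p * ?e)"
    proof -
      have "\<kappa> powr p * exp (- r * z) \<le> \<kappa> powr p * ?e" by (intro mult_left_mono) auto
      also have "\<dots> \<le> E * (\<kappa> powr p * ?e)"
        using E mult_right_mono[of 1 E "\<kappa> powr p * ?e"] by simp
      finally show ?thesis .
    qed
    have s: "s powr p * exp (- s * z) \<le> s powr p * ?e" by (intro mult_left_mono) auto
    have r: "r powr p * exp (- ((r + 1) * p) * z) \<le> r powr p * ?e"
      by (intro mult_left_mono exp_between ex(5,6)) auto
    have "\<kappa> powr p * exp (- r * z) + E * (s powr p * exp (- s * z) + r powr p * exp (- ((r + 1) * p) * z))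
       \<le> E * (\<kappa> powr p * ?e) + E * (s powr p * ?e + r powr p * ?e)"
      using E by (intro add_mono[OF \<kappa>] mult_left_mono[OF add_mono[OF s r]]) auto
    then show ?thesis by (simp add: algebra_simps)
  qed
  finally have main: "exp (- p * z) * a powr p
      \<le> E * (\<kappa> powr p + s powr p + r powr p) * (exp (- s * z) + exp (- r * z))" .
  \<comment> \<open>The exponent \<open>p - 1\<close> is negative, so the floor for \<open>a\<close>
    bounds the power from above; \<open>s * (1 - p) = p\<close> cancels the exponentials and the
    bound is uniform in \<open>z\<close>.\<close>
  have "exp (- p * z) * a powr (p - 1) \<le> exp (- p * z) * (s * exp (- s * z)) powr (p - 1)"
    using a_ge ex(1) p by (intro mult_left_mono powr_mono2') auto
  also have "\<dots> = s powr (p - 1) * (exp (- p * z) * exp (s * (1 - p) * z))"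
    using ex(1) by (simp add: powr_mult exp_powr_real algebra_simps)
  also have "\<dots> = s powr (p - 1)"
    by (simp add: ex(4) flip: exp_add)
  finally have "p * b * (exp (- p * z) * a powr (p - 1)) \<le> p * b * s powr (p - 1)"
    using p b by (intro mult_left_mono) auto
  moreover have "exp (- p * z) * (a + b) powr p \<le> exp (- p * z) * (a powr p + p * a powr (p - 1) * b)"
    using powr_tangent_upper[OF a0 b p] by (intro mult_left_mono) auto
  ultimately show ?thesis using main unfolding a_def[symmetric] by (simp add: algebra_simps)
qed

text \<open>\<open>W\<close> is compared with the supersolution \<open>U\<close> plus a small
  multiple of a penalty \<open>P\<close> that outgrows the growth bound on \<open>W\<close> at both
  ends. The maximum principle excludes a positive excess, and the penalty is then removed.\<close>

lemma upper_bound: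
  obtains B where "B > 0"
    "\<And>t z. t \<in> {0..T} \<Longrightarrow> W t z \<le> K t * exp (q * z) / (- q) + B * (exp (- s * z) + exp (- r * z))"
proof -
  note ex = exponents
  obtain k' where k': "0 < k'" "\<And>t. t \<in> {0..T} \<Longrightarrow> K t \<le> k'"
    using K_bounds by blast
  \<comment> \<open>\<open>J\<close> collects the contribution of the Hamiltonian, using
    \<open>f t \<le> 1\<close> and \<open>K t \<le> k'\<close>. \<open>M\<close> and
    \<open>N\<close> are the rates at which the barrier and the penalty must grow backward in time
    to outweigh the linear and Hamiltonian terms.\<close>
  define J where "J = lam / p * (k' powr p + s powr p + r powr p)"
  define M where "M = \<bar>\<xi> * s\<^sup>2 - (lam - \<xi>) * s\<bar> + \<bar>\<xi> * r\<^sup>2 - (lam - \<xi>) * r\<bar> + J"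
  \<comment> \<open>One more than \<open>\<eta>\<close>, so that \<open>exp (- e * z)\<close> beats
    the growth bound at minus infinity.\<close>
  define e where "e = \<eta> + 1"
  define N where "N = \<bar>\<xi> * e\<^sup>2 - (lam - \<xi>) * e\<bar> + lam * s powr (p - 1) * e"
  have J0: "0 \<le> J" using pos p by (simp add: J_def)
  have e0: "e > 0" using pos by (simp add: e_def)
  have M0: "0 \<le> M" using J0 by (simp add: M_def)
  have N0: "0 \<le> N" using pos e0 by (simp add: N_def)
  define U where "U t z = K t * exp (q * z) / (- q) + exp (M * (T - t)) * (exp (- s * z) + exp (- r * z))" for t z
  define P where "P t z = exp (N * (T - t)) * (exp (- e * z) + exp z)" for t z
  have contU: "continuous_on ({0..T} \<times> UNIV) (\<lambda>(t, z). U t z)"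
    unfolding U_def K_def case_prod_unfold by (intro continuous_intros) (use q in auto)
  have contP: "continuous_on ({0..T} \<times> UNIV) (\<lambda>(t, z). P t z)"
    unfolding P_def case_prod_unfold by (intro continuous_intros)
  have U_nonneg: "0 \<le> U t z" for t z
    unfolding U_def K_def using q by (intro add_nonneg_nonneg divide_nonneg_pos mult_nonneg_nonneg) auto
  have key: "W t z \<le> U t z + \<delta> * P t z" if t: "t \<in> {0..T}" and \<delta>: "\<delta> > 0" for t z \<delta>
  proof (rule ccontr)
    assume "\<not> ?thesis"
    define F where "F t z = W t z - (U t z + \<delta> * P t z)" for t z
    from \<open>\<not> ?thesis\<close> have F0: "F t z > 0" by (simp add: F_def)
    \<comment> \<open>Beyond \<open>A\<close> one has
      \<open>2 * C < \<delta> * exp \<bar>x\<bar>\<close>, so the penalty alone dominates the growth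
      bound.\<close>
    define A where "A = \<bar>ln (2 * C / \<delta>)\<bar>"
    have out: "F t' x < F t z" if "t' \<in> {0..T}" "x \<notin> {- A..A}" for t' x
    proof -
      have x: "ln (2 * C / \<delta>) < \<bar>x\<bar>" using that by (auto simp: A_def)
      have "2 * C / \<delta> < exp \<bar>x\<bar>"
        using x pos \<delta> by (metis divide_pos_pos exp_less_cancel_iff exp_ln mult_pos_pos zero_less_numeral)
      then have "2 * C < \<delta> * exp \<bar>x\<bar>" using \<delta> by (simp add: field_simps)
      have "C * (1 + exp (- \<eta> * x)) \<le> \<delta> * (exp (- e * x) + exp x)"
      proof (cases "x \<ge> 0")
        case True
        then have "exp (- \<eta> * x) \<le> 1" using pos by simp
        then have "C * (1 + exp (- \<eta> * x)) \<le> C * 2" using pos by (intro mult_left_mono) auto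
        also have "\<dots> \<le> \<delta> * exp x" using \<open>2 * C < _\<close> True by simp
        also have "\<dots> \<le> \<delta> * (exp (- e * x) + exp x)" using \<delta> by (intro mult_left_mono) auto
        finally show ?thesis .
      next
        case False
        then have "1 \<le> exp (- \<eta> * x)" using pos by (simp add: mult_nonneg_nonpos)
        then have "C * (1 + exp (- \<eta> * x)) \<le> C * (2 * exp (- \<eta> * x))" using pos by (intro mult_left_mono) auto
        also have "\<dots> = 2 * C * exp (- \<eta> * x)" by simp
        also have "\<dots> \<le> \<delta> * exp (- x) * exp (- \<eta> * x)"
          using \<open>2 * C < _\<close> False by (intro mult_right_mono) auto
        also have "\<dots> = \<delta> * exp (- e * x)" by (simp add: e_def algebra_simps flip: exp_add)
        also have "\<dots> \<le> \<delta> * (exp (- e * x) + exp x)" using \<delta> by (intro mult_left_mono) auto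
        finally show ?thesis .
      qed
      also have "\<dots> \<le> \<delta> * P t' x"
      proof -
        have "1 \<le> exp (N * (T - t'))" using N0 that by simp
        then show ?thesis unfolding P_def using \<delta>
          mult_right_mono[of 1 "exp (N * (T - t'))" "exp (- e * x) + exp x"]
          by (intro mult_left_mono) (auto simp: add_nonneg_nonneg)
      qed
      finally have "W t' x \<le> \<delta> * P t' x" using growth[OF that(1), of x] by simp
      then show ?thesis using F0 U_nonneg[of t' x] by (simp add: F_def)
    qed
    have contF: "continuous_on ({0..T} \<times> UNIV) (\<lambda>(t, z). F t z)"
      unfolding F_def case_prod_unfold
      using cont contU contP unfolding case_prod_unfold by (intro continuous_intros)
    obtain t1 z1 where t1: "t1 \<in> {0..T}" and F1: "F t z \<le> F t1 z1"
        and max: "\<And>s y. s \<in> {0..T} \<Longrightarrow> F s y \<le> F t1 z1"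
      using global_max_exists[OF contF t compact_Icc out] by metis
    define E where "E = exp (M * (T - t1))"
    define D where "D = \<delta> * exp (N * (T - t1))"
    define \<kappa> where "\<kappa> = K t1"
    define a where "a = exp (- s * z1)"
    define b where "b = exp (- r * z1)"
    define c where "c = exp (q * z1)"
    define g where "g = exp (- e * z1)"
    define h where "h = exp z1"
    have P0: "0 < P t1 z1" by (simp add: P_def add_pos_pos)
    have pos_abc: "0 < a" "0 < b" "0 < c" "0 < g" "0 < h" by (auto simp: a_def b_def c_def g_def h_def)
    have E1: "1 \<le> E" using M0 t1 by (simp add: E_def)
    have D0: "0 < D" using \<delta> by (simp add: D_def)
    have \<kappa>0: "0 < \<kappa>" by (simp add: \<kappa>_def K_def)
    have Fpos: "W t1 z1 > \<kappa> * c / (- q) + E * (a + b) + D * (g + h)"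
      using F0 F1 by (simp add: F_def U_def P_def E_def D_def \<kappa>_def a_def b_def c_def g_def h_def)
    have "t1 \<noteq> T"
    proof
      assume "t1 = T"
      then have "W t1 z1 \<le> \<kappa> * c / (- q)" by (simp add: terminal \<kappa>_def c_def K_def)
      with Fpos E1 D0 pos_abc show False by (smt (verit) mult_pos_pos)
    qed
    with t1 have t1': "0 \<le> t1" "t1 < T" by auto
    \<comment> \<open>These are the derivatives of \<open>U + \<delta> * P\<close> at time
      \<open>t1\<close>; \<open>Vz\<close> remains a function of \<open>z\<close> so that it can be
      differentiated again.\<close>
    define Vz where "Vz z = \<kappa> * (- exp (q * z)) - E * (s * exp (- s * z) + r * exp (- r * z))
       + D * (exp z - e * exp (- e * z))" for z
    define Vzz where "Vzz = - \<kappa> * q * c + E * (s\<^sup>2 * a + r\<^sup>2 * b) + D * (h + e\<^sup>2 * g)"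
    define Vt where "Vt = (1 - q) * (lam + \<xi> * q) * \<kappa> * c / (- q) - M * E * (a + b) - N * D * (g + h)"
    have dz: "(F t1 has_real_derivative (Wz t1 z - Vz z)) (at z)" for z
      unfolding F_def U_def P_def Vz_def E_def D_def \<kappa>_def
      by (rule derivative_eq_intros W_z t1 refl | use q in \<open>simp add: field_simps\<close>)+
    have dzz: "((\<lambda>z. Wz t1 z - Vz z) has_real_derivative (Wzz t1 z1 - Vzz)) (at z1)"
      unfolding Vz_def Vzz_def a_def b_def c_def g_def h_def
      by (rule derivative_eq_intros W_zz t1 refl | simp add: power2_eq_square algebra_simps)+
    have dt: "((\<lambda>s. F s z1) has_real_derivative (Wt t1 z1 - Vt)) (at t1 within {0..T})"
      unfolding F_def U_def P_def Vt_def E_def D_def \<kappa>_def K_def a_def b_def c_def g_def h_def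
      by (rule derivative_eq_intros W_t t1 refl | use q in \<open>simp add: field_simps\<close>)+
    have z: "Wz t1 z1 = Vz z1" and zz: "Wzz t1 z1 \<le> Vzz"
      using derivative_tests_at_max[OF dz dzz] max[OF t1] by auto
    have tt: "Wt t1 z1 \<le> Vt"
      using derivative_nonpos_at_max_within[OF dt t1'] max by auto
    have X: "exp (- p * z1) * (- Wz t1 z1) powr p
       \<le> E * (\<kappa> powr p + s powr p + r powr p) * (a + b) + p * s powr (p - 1) * (D * e * g)"
    proof -
      \<comment> \<open>The penalty part \<open>exp z\<close> contributes a negative term to the
        negated gradient and is dropped; the other part becomes the increment \<open>b\<close> of
        the barrier estimate.\<close>
      have "- Wz t1 z1 \<le> \<kappa> * exp (q * z1) + E * (s * exp (- s * z1) + r * exp (- r * z1)) + D * e * g"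
        using D0 unfolding z Vz_def by (simp add: algebra_simps g_def)
      then have "(- Wz t1 z1) powr p \<le> (\<kappa> * exp (q * z1) + E * (s * exp (- s * z1) + r * exp (- r * z1)) + D * e * g) powr p"
        using W_z_nonpos[OF t1, of z1] p by (intro powr_mono2) auto
      then have "exp (- p * z1) * (- Wz t1 z1) powr p \<le> exp (- p * z1) * (\<kappa> * exp (q * z1) + E * (s * exp (- s * z1) + r * exp (- r * z1)) + D * e * g) powr p"
        by (intro mult_left_mono) auto
      also have "\<dots> \<le> E * (\<kappa> powr p + s powr p + r powr p) * (a + b) + p * s powr (p - 1) * (D * e * g)"
        unfolding a_def b_def using \<kappa>0 E1 D0 e0 pos_abc by (intro hamiltonian_barrier_le) auto
      finally show ?thesis .
    qed
    have H: "lam * f t1 / p * (exp (- p * z1) * (- Wz t1 z1) powr p)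
       \<le> J * E * (a + b) + lam * s powr (p - 1) * e * D * g"
    proof -
      have "lam * f t1 / p * (exp (- p * z1) * (- Wz t1 z1) powr p)
         \<le> lam / p * (exp (- p * z1) * (- Wz t1 z1) powr p)"
        using f[OF t1] pos p by (intro mult_right_mono divide_right_mono) auto
      also have "\<dots> \<le> lam / p * (E * (k' powr p + s powr p + r powr p) * (a + b) + p * s powr (p - 1) * (D * e * g))"
      proof (intro mult_left_mono order.trans[OF X] add_right_mono mult_right_mono powr_mono2)
        show "\<kappa> \<le> k'" unfolding \<kappa>_def by (rule k'(2)[OF t1])
      qed (use pos p E1 pos_abc \<kappa>0 in auto)
      also have "\<dots> = J * E * (a + b) + lam * s powr (p - 1) * e * D * g"
        using p by (simp add: J_def field_simps)
      finally show ?thesis .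
    qed
    \<comment> \<open>At the maximum the equation for \<open>W\<close> passes to the barrier with
      strict sign, since the zero-order term has a negative coefficient and \<open>W\<close> is
      strictly above.\<close>
    have "0 < Vt - lam * (\<kappa> * c / (- q) + E * (a + b) + D * (g + h)) + (lam - \<xi>) * Vz z1 + \<xi> * Vzz
        + (J * E * (a + b) + lam * s powr (p - 1) * e * D * g)"
    proof -
      have "lam * (\<kappa> * c / (- q) + E * (a + b) + D * (g + h)) < lam * W t1 z1"
        using Fpos pos by simp
      moreover have "\<xi> * Wzz t1 z1 \<le> \<xi> * Vzz" using zz pos by simp
      ultimately show ?thesis using pde[OF t1, of z1] H tt z by simp
    qed
    \<comment> \<open>The terms in \<open>c\<close> cancel by the choice of \<open>K\<close>. The
      function \<open>exp z\<close> is annihilated by the linear spatial operator, which leaves only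
      \<open>- N\<close> at \<open>h\<close>.\<close>
    also have "\<dots> = E * a * (J - M - lam + \<xi> * s\<^sup>2 - (lam - \<xi>) * s) + E * b * (J - M - lam + \<xi> * r\<^sup>2 - (lam - \<xi>) * r)
       + D * g * (lam * s powr (p - 1) * e - N - lam + \<xi> * e\<^sup>2 - (lam - \<xi>) * e) + D * h * (- N)"
      using q by (simp add: Vt_def Vz_def Vzz_def a_def b_def c_def g_def h_def field_simps power2_eq_square)
    also have "\<dots> \<le> 0"
    proof -
      have "J - M - lam + \<xi> * s\<^sup>2 - (lam - \<xi>) * s \<le> 0" "J - M - lam + \<xi> * r\<^sup>2 - (lam - \<xi>) * r \<le> 0"
        using pos unfolding M_def by linarith+
      moreover have "lam * s powr (p - 1) * e - N - lam + \<xi> * e\<^sup>2 - (lam - \<xi>) * e \<le> 0"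
        using pos unfolding N_def by linarith
      ultimately show ?thesis using E1 D0 pos_abc N0
        by (intro add_nonpos_nonpos mult_nonneg_nonpos) auto
    qed
    finally show False by simp
  qed
  have le_U: "W t z \<le> U t z" if t: "t \<in> {0..T}" for t z
  proof (rule field_le_epsilon)
    fix \<epsilon> :: real assume "\<epsilon> > 0"
    moreover have "P t z > 0" by (simp add: P_def add_pos_pos)
    ultimately show "W t z \<le> U t z + \<epsilon>" using key[OF t, of "\<epsilon> / P t z" z] by simp
  qed
  show ?thesis
  proof (rule that)
    show "exp (M * T) > 0" by simp
    fix t z assume t: "t \<in> {0..T}"
    have "exp (M * (T - t)) * (exp (- s * z) + exp (- r * z)) \<le> exp (M * T) * (exp (- s * z) + exp (- r * z))"
      using t M0 by (intro mult_right_mono) (auto simp: mult_left_mono add_nonneg_nonneg)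
    with le_U[OF t, of z] show "W t z \<le> K t * exp (q * z) / (- q) + exp (M * T) * (exp (- s * z) + exp (- r * z))"
      by (simp add: U_def)
  qed
qed

section \<open>Convexity in ln y by a two-point maximum principle\<close>

text \<open>
  The comparison is made with the factor 1 + \<epsilon>. At a positive maximum the derivative at the
  midpoint is 1 + \<epsilon> times that at the end points, and since the Hamiltonian is homogeneous of
  degree p < 1 this only helps; the factor also makes the leading terms at z \<rightarrow> -\<infinity> dominate.
\<close>

lemma convex_perturbed:
  assumes u: "0 < u" "u < 1" and \<epsilon>: "0 < \<epsilon>" and t0: "t0 \<in> {0..T}"
  shows "W t0 ((1 - u) * x + u * y) \<le> (1 + \<epsilon>) * ((1 - u) * W t0 x + u * W t0 y)"
proof (rule ccontr)
  note ex = exponents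
  define F where "F t v = W t ((1 - u) * fst v + u * snd v) - (1 + \<epsilon>) * ((1 - u) * W t (fst v) + u * W t (snd v))"
    for t and v :: "real \<times> real"
  assume contra: "\<not> ?thesis"
  define m where "m = F t0 (x, y)"
  have m: "0 < m" using contra by (simp add: F_def m_def)
  obtain k where k: "0 < k" "\<And>t. t \<in> {0..T} \<Longrightarrow> k \<le> K t"
    using K_bounds by blast
  obtain B where B: "B > 0"
    "\<And>t z. t \<in> {0..T} \<Longrightarrow> W t z \<le> K t * exp (q * z) / (- q) + B * (exp (- s * z) + exp (- r * z))"
    using upper_bound by blast
  define G where "G z = B * (exp (- s * z) + exp (- r * z))" for z
  define Q where "Q v = (1 - u) * exp (q * fst v) + u * exp (q * snd v)" for v :: "real \<times> real"
  \<comment> \<open>The factor \<open>1 + \<epsilon>\<close> yields a surplus of at least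
    \<open>2 * c * Q v\<close>: one half absorbs the remainder \<open>G\<close> far to the left, the
    other forces decay of \<open>F\<close>.\<close>
  define c where "c = \<epsilon> * k / (- q) / 2"
  have c0: "0 < c" unfolding c_def using \<epsilon> k(1) q by (intro divide_pos_pos mult_pos_pos) auto
  have Q0: "0 < Q v" for v using u by (simp add: Q_def add_pos_pos)
  have Q_ge: "exp (q * ((1 - u) * fst v + u * snd v)) \<le> Q v" for v
    unfolding Q_def by (rule exp_scaled_convex[OF u])
  have F_le: "F t v \<le> G ((1 - u) * fst v + u * snd v) - 2 * c * Q v" if t: "t \<in> {0..T}" for t v
  proof -
    let ?z = "(1 - u) * fst v + u * snd v"
    have Kq: "K t / (- q) > 0" using k(1) k(2)[OF t] q by (intro divide_pos_pos) auto
    have "K t / (- q) * Q v = (1 - u) * (K t * exp (q * fst v) / (- q)) + u * (K t * exp (q * snd v) / (- q))"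
      by (simp add: Q_def algebra_simps add_divide_distrib diff_divide_distrib)
    also have "\<dots> \<le> (1 - u) * W t (fst v) + u * W t (snd v)"
      using u lower[OF t] unfolding K_def by (intro add_mono mult_left_mono) auto
    finally have "(1 + \<epsilon>) * (K t / (- q) * Q v) \<le> (1 + \<epsilon>) * ((1 - u) * W t (fst v) + u * W t (snd v))"
      using \<epsilon> by (intro mult_left_mono) auto
    moreover have "W t ?z \<le> K t / (- q) * Q v + G ?z"
    proof -
      have "K t / (- q) * exp (q * ?z) \<le> K t / (- q) * Q v"
        using Kq by (intro mult_left_mono Q_ge) auto
      then show ?thesis using B(2)[OF t, of ?z] by (simp add: G_def)
    qed
    moreover have "2 * c * Q v \<le> \<epsilon> * (K t / (- q) * Q v)"
    proof -
      have "2 * c \<le> \<epsilon> * (K t / (- q))"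
        using k(2)[OF t] \<epsilon> q by (simp add: c_def field_simps)
      then have "2 * c * Q v \<le> \<epsilon> * (K t / (- q)) * Q v"
        using Q0[of v] by (intro mult_right_mono) auto
      then show ?thesis by (simp only: mult.assoc)
    qed
    moreover have "(1 + \<epsilon>) * (K t / (- q) * Q v) = K t / (- q) * Q v + \<epsilon> * (K t / (- q) * Q v)"
      by (simp only: distrib_right mult_1)
    ultimately show ?thesis unfolding F_def by linarith
  qed
  have r0: "0 < r" using ex by simp
  have G_antimono: "G z' \<le> G z" if "z \<le> z'" for z z'
    unfolding G_def using B(1) ex(1) r0 that by (intro mult_left_mono add_mono) auto
  \<comment> \<open>To the left of \<open>- X\<close> the remainder \<open>G\<close> is below
    \<open>c * exp (q * z)\<close>, because \<open>r < - q\<close>; to the right it is at most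
    \<open>G (- X)\<close>.\<close>
  define X where "X = \<bar>ln (2 * B / c)\<bar> / (- q - r)"
  have G_left: "G z \<le> c * exp (q * z)" if "z \<le> - X" for z
  proof -
    have X0: "0 \<le> X" using ex by (auto simp: X_def intro!: divide_nonneg_pos)
    have "exp (- s * z) \<le> exp (- r * z)"
      using that X0 ex(2) by (simp add: mult_right_mono_neg)
    then have "G z \<le> 2 * B * exp (- r * z)" using B(1) by (simp add: G_def)
    also have "2 * B \<le> c * exp ((q + r) * z)"
    proof -
      have "ln (2 * B / c) \<le> X * (- q - r)" using ex by (simp add: X_def)
      also have "\<dots> \<le> - z * (- q - r)" using that ex by (intro mult_right_mono) auto
      finally have "ln (2 * B / c) \<le> (q + r) * z" by (simp add: algebra_simps)
      then have "2 * B / c \<le> exp ((q + r) * z)"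
        using B(1) c0 by (metis divide_pos_pos exp_le_cancel_iff exp_ln mult_pos_pos zero_less_numeral)
      then show ?thesis using c0 by (simp add: field_simps)
    qed
    then have "2 * B * exp (- r * z) \<le> c * exp ((q + r) * z) * exp (- r * z)"
      by (intro mult_right_mono) auto
    also have "\<dots> = c * exp (q * z)" by (simp add: algebra_simps flip: exp_add)
    finally show ?thesis .
  qed
  define C0 where "C0 = G (- X)"
  have C0: "0 < C0" using B(1) by (simp add: C0_def G_def add_pos_pos)
  have F_le': "F t v \<le> C0 - c * Q v" if t: "t \<in> {0..T}" for t v
  proof -
    let ?z = "(1 - u) * fst v + u * snd v"
    have "G ?z \<le> C0 + c * exp (q * ?z)"
    proof (cases "?z \<le> - X")
      case True
      then show ?thesis using G_left C0 by (simp add: add_increasing)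
    next
      case False
      then show ?thesis using G_antimono[of "- X" ?z] c0 by (simp add: C0_def add_increasing2)
    qed
    also have "c * exp (q * ?z) \<le> c * Q v" using c0 by (intro mult_left_mono Q_ge) auto
    finally show ?thesis using F_le[OF t, of v] by simp
  qed
  define l where "l = min u (1 - u)"
  have l: "0 < l" "l \<le> u" "l \<le> 1 - u" using u by (auto simp: l_def)
  \<comment> \<open>If either coordinate is below \<open>- R\<close>, the surplus makes
    \<open>F\<close> nonpositive. If the intermediate point exceeds \<open>R'\<close>, the remainder
    \<open>G\<close> is already at most \<open>m\<close>.\<close>
  define R where "R = \<bar>ln (C0 / (c * l))\<bar> / (- q)"
  define R' where "R' = \<bar>ln (2 * B / m)\<bar> / s"
  have R0: "0 \<le> R" unfolding R_def using q by (intro divide_nonneg_pos) auto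
  have R'0: "0 \<le> R'" using ex(1) by (simp add: R'_def)
  have large: "C0 \<le> c * l * exp (q * z)" if "z < - R" for z
  proof -
    have "ln (C0 / (c * l)) \<le> R * (- q)" using q by (simp add: R_def)
    also have "\<dots> \<le> - z * (- q)" using that q by (intro mult_right_mono) auto
    finally have "ln (C0 / (c * l)) \<le> q * z" by (simp add: algebra_simps)
    then have "C0 / (c * l) \<le> exp (q * z)"
      using C0 c0 l by (metis divide_pos_pos exp_le_cancel_iff exp_ln mult_pos_pos)
    then show ?thesis using c0 l by (simp add: field_simps)
  qed
  have F_left: "F t v \<le> 0" if t: "t \<in> {0..T}" and v: "fst v < - R \<or> snd v < - R" for t v
  proof -
    have "C0 \<le> c * Q v"
      using v
    proof
      assume "fst v < - R"
      then have "C0 \<le> c * (l * exp (q * fst v))" using large[of "fst v"] by simp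
      also have "\<dots> \<le> c * Q v" unfolding Q_def using c0 l u
        by (intro mult_left_mono add_increasing2 mult_right_mono) auto
      finally show ?thesis .
    next
      assume "snd v < - R"
      then have "C0 \<le> c * (l * exp (q * snd v))" using large[of "snd v"] by simp
      also have "\<dots> \<le> c * Q v" unfolding Q_def using c0 l u
        by (intro mult_left_mono add_increasing mult_right_mono) auto
      finally show ?thesis .
    qed
    then show ?thesis using F_le'[OF t, of v] by simp
  qed
  have F_right: "F t v < m" if t: "t \<in> {0..T}" and v: "R' < (1 - u) * fst v + u * snd v" for t v
  proof -
    let ?z = "(1 - u) * fst v + u * snd v"
    have z0: "0 < ?z" using v R'0 by simp
    have "F t v < G ?z" using F_le[OF t, of v] mult_pos_pos[OF c0 Q0[of v]] by simp
    also have "\<dots> \<le> 2 * B * exp (- s * ?z)"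
    proof -
      have "exp (- r * ?z) \<le> exp (- s * ?z)" using z0 ex(2) by (simp add: mult_right_mono)
      then show ?thesis using B(1) by (simp add: G_def)
    qed
    also have "\<dots> \<le> m"
    proof -
      have "ln (2 * B / m) \<le> R' * s" using ex(1) by (simp add: R'_def)
      also have "\<dots> \<le> ?z * s" using v ex(1) by (intro mult_right_mono) auto
      finally have "2 * B / m \<le> exp (?z * s)"
        using B(1) m by (metis divide_pos_pos exp_le_cancel_iff exp_ln mult_pos_pos zero_less_numeral)
      then have "2 * B \<le> m * exp (s * ?z)" using m by (simp add: field_simps)
      then have "2 * B * exp (- s * ?z) \<le> m * exp (s * ?z) * exp (- s * ?z)"
        by (intro mult_right_mono) auto
      also have "m * exp (s * ?z) * exp (- s * ?z) = m * exp (s * ?z + - s * ?z)"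
        by (simp only: exp_add mult.assoc)
      also have "s * ?z + - s * ?z = 0" by (simp only: mult_minus_left right_minus)
      finally show ?thesis by simp
    qed
    finally show ?thesis .
  qed
  \<comment> \<open>If both coordinates are at least \<open>- R\<close> and one exceeds
    \<open>A\<close>, the intermediate point exceeds \<open>l * A - R = R'\<close>.\<close>
  define A where "A = (R + R') / l"
  have "l \<le> 1" using l by simp
  then have "R * l \<le> R" using R0 by (simp add: mult_left_le)
  then have RA: "R \<le> A" using l(1) R'0 by (simp add: A_def pos_le_divide_eq)
  have out: "F t v < F t0 (x, y)" if t: "t \<in> {0..T}" and v: "v \<notin> {- A..A} \<times> {- A..A}" for t v
  proof -
    obtain a b where ab: "v = (a, b)" by force
    consider "a < - R \<or> b < - R" | "- R \<le> a" "- R \<le> b" "A < a" | "- R \<le> a" "- R \<le> b" "A < b"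
      using v RA unfolding ab mem_Times_iff fst_conv snd_conv atLeastAtMost_iff by linarith
    then show ?thesis
    proof cases
      case 1
      then show ?thesis using F_left[OF t, of v] ab m by (simp add: m_def)
    next
      case 2
      have "R + R' = l * A" using l by (simp add: A_def)
      also have "\<dots> \<le> (1 - u) * A" using l R0 RA by (intro mult_right_mono) auto
      also have "\<dots> < (1 - u) * a" using 2 u by simp
      finally have "R + R' < (1 - u) * a" .
      moreover have "u * (- R) \<le> u * b" using 2 u by (intro mult_left_mono) auto
      moreover have "u * R \<le> R" using u R0 by (simp add: mult_left_le_one_le)
      ultimately have "R' < (1 - u) * fst v + u * snd v" by (simp add: ab)
      then show ?thesis using F_right[OF t] by (simp add: m_def)
    next
      case 3
      have "R + R' = l * A" using l by (simp add: A_def)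
      also have "\<dots> \<le> u * A" using l R0 RA by (intro mult_right_mono) auto
      also have "\<dots> < u * b" using 3 u by simp
      finally have "R + R' < u * b" .
      moreover have "(1 - u) * (- R) \<le> (1 - u) * a" using 3 u by (intro mult_left_mono) auto
      moreover have "(1 - u) * R \<le> R" using u R0 by (simp add: mult_left_le_one_le)
      ultimately have "R' < (1 - u) * fst v + u * snd v" by (simp add: ab)
      then show ?thesis using F_right[OF t] by (simp add: m_def)
    qed
  qed
  have contW: "continuous_on ({0..T} \<times> UNIV) (\<lambda>x. W (fst x) (h (snd x)))"
    if "continuous_on UNIV h" for h :: "real \<times> real \<Rightarrow> real"
  proof -
    have h: "continuous_on ({0..T} \<times> UNIV) (\<lambda>x. h (snd x))"
      by (intro continuous_on_compose2[OF that]) (auto intro: continuous_intros)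
    have "continuous_on ({0..T} \<times> UNIV) (\<lambda>x. (\<lambda>(t, z). W t z) (fst x, h (snd x)))"
      by (rule continuous_on_compose2[OF cont continuous_on_Pair[OF continuous_on_fst[OF continuous_on_id] h]]) auto
    then show ?thesis by simp
  qed
  have contF: "continuous_on ({0..T} \<times> UNIV) (\<lambda>(t, v). F t v)"
    unfolding F_def case_prod_unfold
    by (intro continuous_intros contW[of "\<lambda>v. (1 - u) * fst v + u * snd v"] contW[of fst] contW[of snd])
  obtain t v where t: "t \<in> {0..T}" and Fv: "F t0 (x, y) \<le> F t v"
      and max: "\<And>s v'. s \<in> {0..T} \<Longrightarrow> F s v' \<le> F t v"
    by (rule global_max_exists[OF contF t0 compact_Times[OF compact_Icc compact_Icc] out]) auto
  obtain a b where v: "v = (a, b)" by force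
  define z where "z = (1 - u) * a + u * b"
  have Fpos: "0 < W t z - (1 + \<epsilon>) * ((1 - u) * W t a + u * W t b)"
    using Fv m by (simp add: m_def v z_def F_def)
  have "t \<noteq> T"
  proof
    assume "t = T"
    have "0 \<le> (1 - u) * W T a + u * W T b"
      unfolding terminal using u q
      by (intro add_nonneg_nonneg mult_nonneg_nonneg divide_nonneg_pos) auto
    then have ge: "(1 - u) * W T a + u * W T b \<le> (1 + \<epsilon>) * ((1 - u) * W T a + u * W T b)"
      using \<epsilon> mult_right_mono[of 1 "1 + \<epsilon>"] by fastforce
    have "W T z \<le> (1 - u) * W T a + u * W T b"
      using divide_right_mono[OF exp_scaled_convex[OF u, of q a b], of "- q"] q
      by (simp add: terminal z_def add_divide_distrib)
    also note ge
    finally show False using Fpos \<open>t = T\<close> by simp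
  qed
  with t have t': "0 \<le> t" "t < T" by auto
  have d1: "((\<lambda>h. F t (h, b)) has_real_derivative
      (1 - u) * Wz t ((1 - u) * h + u * b) - (1 + \<epsilon>) * ((1 - u) * Wz t h)) (at h)" for h
    unfolding F_def fst_conv snd_conv
    by (rule derivative_eq_intros DERIV_chain2[OF W_z] t refl | simp)+
  have "(1 - u) * Wz t z - (1 + \<epsilon>) * ((1 - u) * Wz t a) = 0"
    using DERIV_local_max[OF d1[of a], of 1] max[OF t] by (simp add: v z_def)
  then have "(1 - u) * Wz t z = (1 - u) * ((1 + \<epsilon>) * Wz t a)" by simp
  then have za: "Wz t z = (1 + \<epsilon>) * Wz t a" using u by (subst (asm) mult_left_cancel) auto
  have d2: "((\<lambda>h. F t (a, h)) has_real_derivative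
      u * Wz t ((1 - u) * a + u * h) - (1 + \<epsilon>) * (u * Wz t h)) (at h)" for h
    unfolding F_def fst_conv snd_conv
    by (rule derivative_eq_intros DERIV_chain2[OF W_z] t refl | simp)+
  have "u * Wz t z - (1 + \<epsilon>) * (u * Wz t b) = 0"
    using DERIV_local_max[OF d2[of b], of 1] max[OF t] by (simp add: v z_def)
  then have "u * Wz t z = u * ((1 + \<epsilon>) * Wz t b)" by simp
  then have zb: "Wz t z = (1 + \<epsilon>) * Wz t b" using u by (subst (asm) mult_left_cancel) auto
  have ab: "Wz t b = Wz t a" using za zb \<epsilon> by simp
  \<comment> \<open>All three points are shifted by the same \<open>h\<close>. Along this diagonal
    the second-order condition involves \<open>Wzz\<close> at the three points with exactly the
    weights of \<open>F\<close>.\<close>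
  define g' where "g' h = Wz t (z + h) - (1 + \<epsilon>) * ((1 - u) * Wz t (a + h) + u * Wz t (b + h))" for h
  have Fh: "F t (a + h, b + h) = W t (z + h) - (1 + \<epsilon>) * ((1 - u) * W t (a + h) + u * W t (b + h))" for h
    by (simp add: F_def z_def algebra_simps)
  have d3: "((\<lambda>h. F t (a + h, b + h)) has_real_derivative g' h) (at h)" for h
    unfolding Fh g'_def
    by (rule derivative_eq_intros DERIV_chain2[OF W_z] t refl | simp)+
  have d4: "(g' has_real_derivative Wzz t (z + 0) - (1 + \<epsilon>) * ((1 - u) * Wzz t (a + 0) + u * Wzz t (b + 0))) (at 0)"
    unfolding g'_def
    by (rule derivative_eq_intros DERIV_chain2[OF W_zz] t refl | simp)+
  have zz: "Wzz t z - (1 + \<epsilon>) * ((1 - u) * Wzz t a + u * Wzz t b) \<le> 0"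
    using derivative_tests_at_max(2)[OF d3 d4] max[OF t] by (simp add: v)
  have d5: "((\<lambda>s. F s v) has_real_derivative (Wt t z - (1 + \<epsilon>) * ((1 - u) * Wt t a + u * Wt t b)))
      (at t within {0..T})"
    unfolding F_def v fst_conv snd_conv z_def
    by (rule derivative_eq_intros W_t t refl | simp)+
  have tt: "Wt t z - (1 + \<epsilon>) * ((1 - u) * Wt t a + u * Wt t b) \<le> 0"
    using derivative_nonpos_at_max_within[OF d5 t'] max by auto
  define S where "S = - Wz t a"
  have S0: "0 \<le> S" using W_z_nonpos[OF t] by (simp add: S_def)
  define H where "H z = exp (- p * z) * (- Wz t z) powr p" for z
  \<comment> \<open>Since the gradients at \<open>a\<close> and \<open>b\<close> agree,
    \<open>S powr p\<close> is a common factor; what remains is convexity of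
    \<open>exp (- p * z)\<close> and
    \<open>(1 + \<epsilon>) powr p \<le> 1 + \<epsilon>\<close>.\<close>
  have H: "H z \<le> (1 + \<epsilon>) * ((1 - u) * H a + u * H b)"
  proof -
    let ?e = "(1 - u) * exp (- p * a) + u * exp (- p * b)"
    have "- Wz t z = (1 + \<epsilon>) * S" using za by (simp add: S_def)
    then have "H z = (1 + \<epsilon>) powr p * (S powr p * exp (- p * z))"
      using S0 \<epsilon> by (simp add: H_def powr_mult)
    also have "\<dots> \<le> (1 + \<epsilon>) * (S powr p * ?e)"
    proof (intro mult_mono)
      show "(1 + \<epsilon>) powr p \<le> 1 + \<epsilon>" using powr_mono[of p 1 "1 + \<epsilon>"] p \<epsilon> by auto
      show "exp (- p * z) \<le> ?e" using exp_scaled_convex[OF u, of "- p" a b] by (simp add: z_def)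
    qed (use \<epsilon> S0 in auto)
    also have "S powr p * ?e = (1 - u) * H a + u * H b"
      by (simp add: H_def S_def ab algebra_simps)
    finally show ?thesis .
  qed
  define i where "i = lam * f t / p"
  have "0 \<le> i" using f(1)[OF t] pos p by (simp add: i_def)
  have eq: "Wt t z = lam * W t z - (lam - \<xi>) * Wz t z - \<xi> * Wzz t z - i * H z" for z
    using pde[OF t, of z] by (simp add: H_def i_def)
  \<comment> \<open>The equations at the three points are combined with the weights of
    \<open>F\<close>. The drift terms cancel and all other terms on the right are nonpositive,
    against a positive left side.\<close>
  have "lam * (W t z - (1 + \<epsilon>) * ((1 - u) * W t a + u * W t b))
      = (Wt t z - (1 + \<epsilon>) * ((1 - u) * Wt t a + u * Wt t b))
       + \<xi> * (Wzz t z - (1 + \<epsilon>) * ((1 - u) * Wzz t a + u * Wzz t b))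
       + i * (H z - (1 + \<epsilon>) * ((1 - u) * H a + u * H b))
       + (lam - \<xi>) * (Wz t z - (1 + \<epsilon>) * ((1 - u) * Wz t a + u * Wz t b))"
    unfolding eq by (simp add: algebra_simps)
  also have "Wz t z - (1 + \<epsilon>) * ((1 - u) * Wz t a + u * Wz t b) = 0"
    by (simp add: za ab algebra_simps)
  also have "(Wt t z - (1 + \<epsilon>) * ((1 - u) * Wt t a + u * Wt t b))
       + \<xi> * (Wzz t z - (1 + \<epsilon>) * ((1 - u) * Wzz t a + u * Wzz t b))
       + i * (H z - (1 + \<epsilon>) * ((1 - u) * H a + u * H b)) + (lam - \<xi>) * 0 \<le> 0"
    using tt zz H pos \<open>0 \<le> i\<close> by (simp add: add_nonpos_nonpos mult_nonneg_nonpos)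
  finally show False using Fpos pos by (simp add: mult_le_0_iff)
qed

text \<open>This is the limit of vanishing \<open>\<epsilon>\<close>; scaling it by
  \<open>1 + \<bar>?c\<bar>\<close> keeps the error below \<open>\<delta>\<close>.\<close>

lemma convex_in_log:
  assumes u: "0 < u" "u < 1" and t: "t \<in> {0..T}"
  shows "W t ((1 - u) * x + u * y) \<le> (1 - u) * W t x + u * W t y"
proof (rule field_le_epsilon)
  fix \<delta> :: real assume \<delta>: "\<delta> > 0"
  let ?c = "(1 - u) * W t x + u * W t y"
  have "W t ((1 - u) * x + u * y) \<le> (1 + \<delta> / (1 + \<bar>?c\<bar>)) * ?c"
    using \<delta> by (intro convex_perturbed u t) (simp add: add_pos_nonneg)
  also have "\<dots> = ?c + \<delta> * (?c / (1 + \<bar>?c\<bar>))" by (simp add: algebra_simps add_divide_distrib)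
  also have "\<delta> * (?c / (1 + \<bar>?c\<bar>)) \<le> \<delta>"
    using \<delta> by (intro mult_left_le) (auto simp: divide_le_eq_1)
  finally show "W t ((1 - u) * x + u * y) \<le> ?c + \<delta>" by simp
qed

end

section \<open>Return to the variable y\<close>

text \<open>The graph of ln lies strictly below its tangent at the arithmetic mean \<open>a\<close>
  except at \<open>a\<close> itself, and the weighted tangent values sum to zero.\<close>

lemma geometric_mean_less_arithmetic_mean:
  fixes x y u :: real
  assumes "0 < u" "u < 1" "0 < x" "0 < y" "x \<noteq> y"
  shows "exp ((1 - u) * ln x + u * ln y) < (1 - u) * x + u * y"
proof -
  define a where "a = (1 - u) * x + u * y"
  have a: "0 < a" using assms by (simp add: a_def add_pos_pos)
  have ln_less: "ln (z / a) < z / a - 1" if "0 < z" "z \<noteq> a" for z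
  proof -
    have "0 < z / a" "z / a \<noteq> 1" using that a by auto
    then show ?thesis
      using ln_le_minus_one[of "z / a"] ln_eq_minus_one[of "z / a"] by fastforce
  qed
  have "x - a = u * (x - y)" "y - a = (1 - u) * (y - x)" by (simp_all add: a_def algebra_simps)
  then have "x \<noteq> a" "y \<noteq> a" using assms by auto
  then have "(1 - u) * ln (x / a) + u * ln (y / a) < (1 - u) * (x / a - 1) + u * (y / a - 1)"
    using assms by (intro add_strict_mono mult_strict_left_mono ln_less) auto
  also have "\<dots> = ((1 - u) * x + u * y) / a - 1"
    by (simp add: algebra_simps add_divide_distrib diff_divide_distrib)
  also have "\<dots> = 0" using a by (simp flip: a_def)
  finally have "(1 - u) * ln x + u * ln y < ln a"
    using assms a by (simp add: ln_div algebra_simps)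
  then have "exp ((1 - u) * ln x + u * ln y) < exp (ln a)"
    by (simp only: exp_less_cancel_iff)
  then show ?thesis unfolding exp_ln[OF a] by (simp only: a_def)
qed

theorem corollary3p6:
  fixes T lam \<mu> \<sigma> p1 p2 q1 \<xi> \<gamma> :: real
    and f :: "real \<Rightarrow> real"
    and w :: "real \<Rightarrow> real \<Rightarrow> real"
  assumes "T > 0" "lam > 0" "\<mu> > 0" "\<sigma> > 0"
    and "0 < p1" "p1 < 1" "0 < p2" "p2 < 1" "p1 > p2"
    and xi: "\<xi> = \<mu>\<^sup>2 / (2 * \<sigma>\<^sup>2)"
    and q1: "q1 < 0" "1 / p1 + 1 / q1 = 1"
    and f: "f = (\<lambda>t. exp (- \<xi> * (T - t)))"
    and gamma: "0 < \<gamma>" "\<gamma> < 1"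
    and regularity: "parabolic_holder_class \<gamma> T w"
    and pde: "\<And>t y. t \<in> {0..T} \<Longrightarrow> y > 0 \<Longrightarrow>
        dt T w t y - lam * w t y + lam * y * dy w t y + \<xi> * y\<^sup>2 * dy (dy w) t y
          + lam * f t * ((- dy w t y) powr p2 / p2) = 0"
    and terminal: "\<And>y. y > 0 \<Longrightarrow> w T y = - (y powr q1 / q1)"
    and lower_bound: "\<And>t y. t \<in> {0..<T} \<Longrightarrow> y > 0 \<Longrightarrow>
        w t y > - exp ((q1 - 1) * (lam + \<xi> * q1) * (T - t)) * (y powr q1 / q1) \<and>
        - exp ((q1 - 1) * (lam + \<xi> * q1) * (T - t)) * (y powr q1 / q1) > 0"
    and decreasing: "\<And>t. t \<in> {0..T} \<Longrightarrow> strict_antimono_on {0<..} (w t)"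
    and growth: "\<exists>\<eta>>0. \<exists>C>0. \<forall>t\<in>{0..T}. \<forall>y>0. w t y \<le> C * (1 + y powr (- \<eta>))"
  shows "\<forall>t\<in>{0..T}. strictly_convex_on {0<..} (w t)"
proof -
  obtain \<eta> C where \<eta>: "\<eta> > 0" "C > 0"
      "\<And>t y. t \<in> {0..T} \<Longrightarrow> y > 0 \<Longrightarrow> w t y \<le> C * (1 + y powr (- \<eta>))"
    using growth by blast
  have C12: "C12 T w" using regularity by (simp add: parabolic_holder_class_def)
  have \<xi>0: "\<xi> > 0" using assms(3,4) xi by simp
  have w_t: "((\<lambda>s. w s y) has_real_derivative dt T w t y) (at t within {0..T})"
    if "t \<in> {0..T}" "y > 0" for t y
  proof -
    have "(\<lambda>s. w s y) differentiable (at t within {0..T})"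
      using C12 that unfolding C12_def by blast
    then show ?thesis
      unfolding dt_def has_real_derivative_iff_has_vector_derivative
      by (rule iffD1[OF vector_derivative_works])
  qed
  have w_y: "(w t has_real_derivative dy w t y) (at y)"
    and w_yy: "(dy w t has_real_derivative dy (dy w) t y) (at y)"
    if "t \<in> {0..T}" "y > 0" for t y
  proof -
    have "w t differentiable (at y)" "dy w t differentiable (at y)"
      using C12 that unfolding C12_def by blast+
    then show "(w t has_real_derivative dy w t y) (at y)"
      "(dy w t has_real_derivative dy (dy w) t y) (at y)"
      unfolding dy_def[of w t y] dy_def[of "dy w" t y]
      by (simp_all only: DERIV_deriv_iff_real_differentiable)
  qed
  have contw: "continuous_on ({0..T} \<times> {0<..}) (\<lambda>(t, y). w t y)"
    using C12 by (simp add: C12_def)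
  have less: "w t y < w t x" if "t \<in> {0..T}" "0 < x" "x < y" for t x y
    using decreasing[OF that(1)] that by (auto simp: monotone_on_def)
  have dy_nonpos: "dy w t y \<le> 0" if t: "t \<in> {0..T}" and y: "y > 0" for t y
  proof (rule ccontr)
    assume "\<not> dy w t y \<le> 0"
    then obtain e where e: "e > 0" "\<And>h. 0 < h \<Longrightarrow> h < e \<Longrightarrow> w t y < w t (y + h)"
      using DERIV_pos_inc_right[OF w_y[OF t y]] by auto
    then have "w t y < w t (y + e / 2)" by simp
    with less[OF t y, of "y + e / 2"] e(1) show False by simp
  qed
  \<comment> \<open>By conjugacy \<open>- q1 = p1 / (1 - p1)\<close>, and
    \<open>(1 - p2) / (1 - p1) > 1\<close>, so the right side exceeds \<open>p1\<close>.\<close>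
  have p2q: "p2 < - q1 * (1 - p2)"
  proof -
    have "q1 = - p1 / (1 - p1)" using q1 assms(5,6) by (simp add: field_simps)
    then have "- q1 * (1 - p2) = p1 * ((1 - p2) / (1 - p1))" by simp
    also have "\<dots> > p1 * 1" using assms(5-9) by (intro mult_strict_left_mono) auto
    finally show ?thesis using assms(9) by simp
  qed
  interpret log_equation T lam \<xi> p2 q1 \<eta> C f "\<lambda>t z. w t (exp z)" "\<lambda>t z. dt T w t (exp z)"
    "\<lambda>t z. exp z * dy w t (exp z)" "\<lambda>t z. exp z * dy w t (exp z) + (exp z)\<^sup>2 * dy (dy w) t (exp z)"
  proof
    show "continuous_on ({0..T} \<times> UNIV) (\<lambda>(t, z). w t (exp z))"
      using continuous_on_compose2[OF contw, of "{0..T} \<times> UNIV" "\<lambda>x. (fst x, exp (snd x))"]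
      by (force simp: case_prod_unfold intro: continuous_intros)
    fix t z :: real
    show "w T (exp z) = exp (q1 * z) / (- q1)"
      using terminal[of "exp z"] by (simp add: exp_powr_real mult.commute)
    assume t: "t \<in> {0..T}"
    show "((\<lambda>s. w s (exp z)) has_real_derivative dt T w t (exp z)) (at t within {0..T})"
      by (rule w_t[OF t]) simp
    show "((\<lambda>z. w t (exp z)) has_real_derivative exp z * dy w t (exp z)) (at z)"
      using DERIV_chain2[OF w_y[OF t exp_gt_zero] DERIV_exp, of z] by (simp add: mult.commute)
    show "((\<lambda>z. exp z * dy w t (exp z)) has_real_derivative
        exp z * dy w t (exp z) + (exp z)\<^sup>2 * dy (dy w) t (exp z)) (at z)"
      by (rule derivative_eq_intros DERIV_chain2[OF w_yy] t refl | simp add: power2_eq_square)+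
    show "exp z * dy w t (exp z) \<le> 0"
      using dy_nonpos[OF t] by (simp add: mult_le_0_iff)
    \<comment> \<open>Passing to the gradient in z costs a factor \<open>exp (p2 * z)\<close>, which
      the weight in the Hamiltonian undoes.\<close>
    have "(- (exp z * dy w t (exp z))) powr p2 = exp (p2 * z) * (- dy w t (exp z)) powr p2"
      using powr_mult[of "exp z" "- dy w t (exp z)" p2] dy_nonpos[OF t, of "exp z"]
      by (simp add: exp_powr_real mult.commute)
    then have "exp (- p2 * z) * (- (exp z * dy w t (exp z))) powr p2 = (- dy w t (exp z)) powr p2"
      by (simp add: exp_minus)
    then show "dt T w t (exp z) - lam * w t (exp z) + (lam - \<xi>) * (exp z * dy w t (exp z))
        + \<xi> * (exp z * dy w t (exp z) + (exp z)\<^sup>2 * dy (dy w) t (exp z))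
        + lam * f t / p2 * (exp (- p2 * z) * (- (exp z * dy w t (exp z))) powr p2) = 0"
      using pde[OF t, of "exp z"] by (simp add: algebra_simps)
    show "exp ((q1 - 1) * (lam + \<xi> * q1) * (T - t)) * exp (q1 * z) / (- q1) \<le> w t (exp z)"
    \<comment> \<open>The strict lower bound is given only before \<open>T\<close>; at
      \<open>T\<close> the terminal condition gives equality.\<close>
    proof (cases "t = T")
      case True
      then show ?thesis using terminal[of "exp z"] by (simp add: exp_powr_real mult.commute)
    next
      case False
      then show ?thesis
        using lower_bound[of t "exp z"] t by (simp add: exp_powr_real mult.commute[of z q1])
    qed
    show "w t (exp z) \<le> C * (1 + exp (- \<eta> * z))"
      using \<eta>(3)[OF t, of "exp z"] by (simp add: exp_powr_real mult.commute)
    show "0 < f t" "f t \<le> 1" using t \<xi>0 by (simp_all add: f)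
  qed (use assms \<xi>0 \<eta> p2q in auto)
  show ?thesis
  proof (intro ballI)
    fix t assume t: "t \<in> {0..T}"
    have "w t ((1 - u) * x + u * y) < (1 - u) * w t x + u * w t y"
      if "0 < x" "0 < y" "x \<noteq> y" "0 < u" "u < 1" for x y u
    proof -
      have "w t ((1 - u) * x + u * y) < w t (exp ((1 - u) * ln x + u * ln y))"
        using geometric_mean_less_arithmetic_mean that by (intro less[OF t]) auto
      also have "\<dots> \<le> (1 - u) * w t x + u * w t y"
        using convex_in_log[OF that(4,5) t, of "ln x" "ln y"] that by simp
      finally show ?thesis .
    qed
    then show "strictly_convex_on {0<..} (w t)"
      by (auto simp: strictly_convex_on_def)
  qed
qed

end
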